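(* Let $\alpha,\beta>0$, let $A\in\mathbb{R}^{n\times p}$, let $k$ be a positive integer, and let $x_0\in\mathbb{R}^p$ be $k$-sparse. If $A$ satisfies the restricted isometry property with $\delta_{2k}(A)\le0.4663$ and $\beta\le\frac{1}{20\alpha}$, then, with $y=Ax_0$, $x_0$ is the unique minimizer of $$\min_{x\in\mathbb{R}^p}\{\|x\|_1+\beta\Phi(x):Ax=y\}.$$
   Context: $\Phi(x)=\sum_{i=1}^p\varphi(x_i)$ with $\varphi(t)=\frac{\alpha|t|}{1+\alpha|t|}$. A vector is $k$-sparse if it has at most $k$ nonzero entries. The $k$-th restricted isometry constant $\delta_k(A)$ of $A\in\mathbb{R}^{n\times p}$ is the smallest $\delta\ge0$ such that $(1-\delta)\|x\|_2^2\le\|Ax\|_2^2\le(1+\delta)\|x\|_2^2$ for all $k$-sparse $x\in\mathbb{R}^p$. *)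

theory Defs
  imports "HOL-Analysis.Analysis"
begin

definition k_sparse :: "nat \<Rightarrow> real ^ 'p \<Rightarrow> bool" where
  "k_sparse k x \<longleftrightarrow> card {i. x $ i \<noteq> 0} \<le> k"

definition l1_norm :: "real ^ 'p \<Rightarrow> real" where
  "l1_norm x = (\<Sum>i\<in>UNIV. \<bar>x $ i\<bar>)"

definition phi :: "real \<Rightarrow> real \<Rightarrow> real" where
  "phi \<alpha> t = \<alpha> * \<bar>t\<bar> / (1 + \<alpha> * \<bar>t\<bar>)"

definition Phi :: "real \<Rightarrow> real ^ 'p \<Rightarrow> real" where
  "Phi \<alpha> x = (\<Sum>i\<in>UNIV. phi \<alpha> (x $ i))"

definition restricted_isometry :: "real ^ 'p ^ 'n \<Rightarrow> nat \<Rightarrow> real \<Rightarrow> bool" where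
  "restricted_isometry A k \<delta> \<longleftrightarrow>
     (\<forall>x. k_sparse k x \<longrightarrow>
        (1 - \<delta>) * (norm x)\<^sup>2 \<le> (norm (A *v x))\<^sup>2 \<and>
        (norm (A *v x))\<^sup>2 \<le> (1 + \<delta>) * (norm x)\<^sup>2)"

(* The infimum is attained, see ric_least below. *)
definition ric :: "real ^ 'p ^ 'n \<Rightarrow> nat \<Rightarrow> real" where
  "ric A k = Inf {\<delta>. 0 \<le> \<delta> \<and> restricted_isometry A k \<delta>}"

lemma ric_least:
  fixes A :: "real ^ 'p ^ 'n"
  shows "0 \<le> ric A k" and "restricted_isometry A k (ric A k)"
    and "\<And>\<delta>. 0 \<le> \<delta> \<Longrightarrow> restricted_isometry A k \<delta> \<Longrightarrow> ric A k \<le> \<delta>"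
proof -
  let ?S = "{\<delta>. 0 \<le> \<delta> \<and> restricted_isometry A k \<delta>}"
  obtain K where K: "\<And>x. norm (A *v x) \<le> norm x * K"
    using bounded_linear.bounded[OF matrix_vector_mul_bounded_linear[of A]] by blast
  have "restricted_isometry A k (1 + K\<^sup>2)"
    unfolding restricted_isometry_def
  proof (intro allI impI conjI)
    fix x :: "real ^ 'p"
    have "(1 - (1 + K\<^sup>2)) * (norm x)\<^sup>2 \<le> 0" by (simp add: mult_nonneg_nonneg)
    then show "(1 - (1 + K\<^sup>2)) * (norm x)\<^sup>2 \<le> (norm (A *v x))\<^sup>2"
      by (rule order_trans) simp
    have "(norm (A *v x))\<^sup>2 \<le> (norm x * K)\<^sup>2"
      by (rule power_mono[OF K]) simp
    also have "\<dots> = K\<^sup>2 * (norm x)\<^sup>2" by (simp add: power_mult_distrib mult.commute)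
    also have "\<dots> \<le> (1 + (1 + K\<^sup>2)) * (norm x)\<^sup>2" by (rule mult_right_mono) simp_all
    finally show "(norm (A *v x))\<^sup>2 \<le> (1 + (1 + K\<^sup>2)) * (norm x)\<^sup>2" .
  qed
  then have ne: "?S \<noteq> {}" by (auto intro!: exI[of _ "1 + K\<^sup>2"])
  have bdd: "bdd_below ?S" by (auto intro: bdd_belowI)
  have "?S = {0..} \<inter> (\<Inter>x\<in>{x. k_sparse k x}.
      {\<delta>. (1 - \<delta>) * (norm x)\<^sup>2 \<le> (norm (A *v x))\<^sup>2} \<inter>
      {\<delta>. (norm (A *v x))\<^sup>2 \<le> (1 + \<delta>) * (norm x)\<^sup>2})"
    by (auto simp: restricted_isometry_def)
  moreover have "closed \<dots>"
    by (intro closed_Int closed_INT ballI closed_Collect_le continuous_intros closed_atLeast)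
  ultimately have "closed ?S" by simp
  then have "Inf ?S \<in> ?S" by (rule closed_contains_Inf[OF ne bdd])
  then show "0 \<le> ric A k" "restricted_isometry A k (ric A k)" by (auto simp: ric_def)
  show "\<And>\<delta>. 0 \<le> \<delta> \<Longrightarrow> restricted_isometry A k \<delta> \<Longrightarrow> ric A k \<le> \<delta>"
    unfolding ric_def by (rule cInf_lower[OF _ bdd]) simp
qed

end

theory Submission
  imports Defs
begin

text \<open>
  The function \<open>F t = \<bar>t\<bar> + \<beta> * phi \<alpha> t\<close> is subadditive and satisfies
  \<open>\<bar>t\<bar> \<le> F t \<le> (1 + \<alpha> * \<beta>) * \<bar>t\<bar> \<le> 21/20 * \<bar>t\<bar>\<close>. Hence \<open>x0\<close> is the
  unique minimizer as soon as every nonzero \<open>h\<close> in the kernel of \<open>A\<close> satisfies the null space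
  property \<open>21/20 * \<parallel>h\<^sub>S\<parallel>\<^sub>1 < \<parallel>h\<^sub>-\<^sub>S\<parallel>\<^sub>1\<close>, where \<open>S\<close> is the support of \<open>x0\<close>.
  It suffices to consider the set \<open>S\<close> of the \<open>k\<close> largest entries of \<open>h\<close>. Put \<open>u = h\<^sub>S\<close> and
  \<open>D = \<delta> / sqrt (1 - \<delta>\<^sup>2)\<close>. Cut the complement of \<open>S\<close>, in decreasing order of the entries,
  into blocks \<open>w\<close> of size \<open>k\<close>. Restricted isometry on the span of \<open>u\<close> and \<open>w\<close> gives
  \<open>\<parallel>u\<parallel> * \<bar>Au \<bullet> Aw\<bar> \<le> D * \<parallel>Au\<parallel>\<^sup>2 * \<parallel>w\<parallel>\<close>. Each block with entries in \<open>[m, M]\<close> satisfies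
  \<open>\<parallel>w\<parallel>\<^sub>2 \<le> \<parallel>w\<parallel>\<^sub>1 / sqrt k + sqrt k * (M - m) / 4\<close>, whose last terms telescope. Since
  \<open>\<parallel>Au\<parallel>\<^sup>2\<close> is minus the sum of all \<open>Au \<bullet> Aw\<close>, one obtains
  \<open>\<parallel>h\<^sub>S\<parallel>\<^sub>1 \<le> D * (\<parallel>h\<^sub>-\<^sub>S\<parallel>\<^sub>1 + \<parallel>h\<^sub>S\<parallel>\<^sub>1 / 4)\<close>, and \<open>\<delta> \<le> 0.4663\<close> gives \<open>D \<le> 3/5\<close>.
\<close>

section \<open>Sets of largest entries\<close>

lemma obtain_largest_subset:
  fixes f :: "'a \<Rightarrow> 'b::linorder"
  assumes "finite T" "s \<le> card T"
  obtains S where "S \<subseteq> T" "card S = s" "\<And>i j. i \<in> S \<Longrightarrow> j \<in> T - S \<Longrightarrow> f j \<le> f i"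
  using assms
proof (induction s arbitrary: thesis)
  case 0
  show ?case by (rule 0(1)[of "{}"]) auto
next
  case (Suc s)
  then obtain S where S: "S \<subseteq> T" "card S = s" "\<And>i j. i \<in> S \<Longrightarrow> j \<in> T - S \<Longrightarrow> f j \<le> f i"
    by (metis Suc_leD)
  have fin: "finite S" "finite (T - S)" using S(1) assms(1) finite_subset by auto
  have "card (T - S) > 0" using S Suc.prems(3) fin by (simp add: card_Diff_subset)
  then have ne: "T - S \<noteq> {}" by (metis card.empty less_irrefl)
  have "Max (f ` (T - S)) \<in> f ` (T - S)" using fin ne by (intro Max_in) auto
  then obtain a where a: "a \<in> T - S" "f a = Max (f ` (T - S))" by auto
  then have a_max: "f j \<le> f a" if "j \<in> T - S" for j using that fin by simp
  show ?case
    by (rule Suc.prems(1)[of "insert a S"]) (use S a(1) a_max fin in auto)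
qed

text \<open>After the common part is cancelled, every value on \<open>T - S\<close> is at most the
  minimum \<open>m\<close> of \<open>f\<close> on \<open>S\<close>, and every value on
  \<open>S - T\<close> is at least \<open>m\<close>. As m \<ge> 0 and \<open>T - S\<close> has no
  more elements than \<open>S - T\<close>, comparing with multiples of \<open>m\<close>
  suffices.\<close>

lemma sum_le_sum_largest:
  fixes f :: "'a \<Rightarrow> real"
  assumes "finite S" "finite T" "card T \<le> card S"
    and nonneg: "\<And>i. i \<in> S \<Longrightarrow> 0 \<le> f i"
    and largest: "\<And>i j. i \<in> S \<Longrightarrow> j \<in> T - S \<Longrightarrow> f j \<le> f i"
  shows "sum f T \<le> sum f S"
proof (cases "S = {}")
  case True
  with assms(2,3) show ?thesis by auto
next
  case False
  define m where "m = Min (f ` S)"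
  have m: "m \<in> f ` S" "\<And>i. i \<in> S \<Longrightarrow> m \<le> f i"
    unfolding m_def using False assms(1) by auto
  have m0: "0 \<le> m" using m(1) nonneg by auto
  have c: "card (T - S) \<le> card (S - T)"
    using assms(1-3) card_Diff_subset_Int[of T S] card_Diff_subset_Int[of S T]
    by (simp add: Int_commute diff_le_mono)
  have "sum f (T - S) \<le> real (card (T - S)) * m"
    using m(1) largest by (intro sum_bounded_above) auto
  also have "\<dots> \<le> real (card (S - T)) * m" using c m0 by (intro mult_right_mono) auto
  also have "\<dots> \<le> sum f (S - T)" using m(2) by (intro sum_bounded_below) auto
  finally have "sum f (T - S) \<le> sum f (S - T)" .
  moreover have "sum f T = sum f (T \<inter> S) + sum f (T - S)"
    by (simp add: assms(2) sum.Int_Diff)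
  moreover have "sum f S = sum f (T \<inter> S) + sum f (S - T)"
    using sum.Int_Diff[OF assms(1), of f T] by (simp add: Int_commute)
  ultimately show ?thesis by simp
qed

section \<open>Norms of restrictions\<close>

definition restrict_vec :: "'p set \<Rightarrow> real ^ 'p \<Rightarrow> real ^ 'p" where
  "restrict_vec S x = (\<chi> i. if i \<in> S then x $ i else 0)"

lemma restrict_vec_nth [simp]: "restrict_vec S x $ i = (if i \<in> S then x $ i else 0)"
  by (simp add: restrict_vec_def)

lemma norm_restrict_vec_sq: "(norm (restrict_vec S x))\<^sup>2 = (\<Sum>i\<in>S. \<bar>x $ i\<bar>\<^sup>2)"
proof -
  have "(norm (restrict_vec S x))\<^sup>2 = (\<Sum>i\<in>UNIV. (if i \<in> S then x $ i else 0)\<^sup>2)"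
    by (simp add: norm_vec_def L2_set_def sum_nonneg)
  also have "\<dots> = (\<Sum>i\<in>UNIV. if i \<in> S then \<bar>x $ i\<bar>\<^sup>2 else 0)" by (intro sum.cong) auto
  finally show ?thesis by (simp add: sum.If_cases)
qed

lemma restrict_vec_Un:
  assumes "S \<inter> T = {}"
  shows "restrict_vec (S \<union> T) x = restrict_vec S x + restrict_vec T x"
  using assms by (auto simp: vec_eq_iff)

lemma l1_le_sqrt_card_norm:
  "(\<Sum>i\<in>S. \<bar>x $ i\<bar>) \<le> sqrt (card S) * norm (restrict_vec S x)"
proof -
  have "(\<Sum>i\<in>S. \<bar>x $ i\<bar>)\<^sup>2 \<le> card S * (\<Sum>i\<in>S. \<bar>x $ i\<bar>\<^sup>2)"
    using sum_squared_le_sum_of_squares[of "\<lambda>i. \<bar>x $ i\<bar>" S] by (simp add: mult.commute)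
  also have "\<dots> = (sqrt (card S) * norm (restrict_vec S x))\<^sup>2"
    by (simp only: power_mult_distrib norm_restrict_vec_sq) simp
  finally show ?thesis by (rule power2_le_imp_le) simp
qed

lemma k_sparse_restrict:
  assumes "card S \<le> k" "\<And>i. i \<notin> S \<Longrightarrow> x $ i = 0"
  shows "k_sparse k x"
  unfolding k_sparse_def
  by (rule order_trans[OF card_mono assms(1)]) (use assms(2) in auto)

text \<open>Summing \<open>(\<bar>x $ i\<bar> - m) * (M - \<bar>x $ i\<bar>) \<ge> 0\<close> bounds
  the squared norm linearly in the l1 norm. The alternative \<open>m = 0 \<or> card T = k\<close>
  lets \<open>card T * m\<close> be replaced by \<open>k * m\<close>, so a block shorter than
  \<open>k\<close> has lower bound 0.\<close>

lemma block_norm_le: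
  assumes "card T \<le> k" "k > 0" "0 \<le> m" "m = 0 \<or> card T = k"
    and bounds: "\<And>i. i \<in> T \<Longrightarrow> m \<le> \<bar>x $ i\<bar> \<and> \<bar>x $ i\<bar> \<le> M" and "m \<le> M"
  shows "norm (restrict_vec T x) \<le> (\<Sum>i\<in>T. \<bar>x $ i\<bar>) / sqrt k + sqrt k * (M - m) / 4"
proof -
  define X where "X = (\<Sum>i\<in>T. \<bar>x $ i\<bar>)"
  define r where "r = sqrt k"
  have r: "r > 0" "r\<^sup>2 = k" using assms(2) by (auto simp: r_def)
  have X0: "0 \<le> X" by (simp add: X_def sum_nonneg)
  have cm: "card T * m = k * m" using assms(4) by auto
  have "0 \<le> (\<Sum>i\<in>T. (\<bar>x $ i\<bar> - m) * (M - \<bar>x $ i\<bar>))"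
    using bounds by (intro sum_nonneg mult_nonneg_nonneg) auto
  also have "\<dots> = (\<Sum>i\<in>T. (M + m) * \<bar>x $ i\<bar> - m * M - \<bar>x $ i\<bar>\<^sup>2)"
    by (intro sum.cong) (auto simp: algebra_simps power2_eq_square)
  also have "\<dots> = (M + m) * X - card T * m * M - (\<Sum>i\<in>T. \<bar>x $ i\<bar>\<^sup>2)"
    by (simp add: sum_subtractf sum_distrib_left X_def)
  finally have "(norm (restrict_vec T x))\<^sup>2 \<le> (M + m) * X - r\<^sup>2 * m * M"
    by (simp add: norm_restrict_vec_sq cm r)
  also have "\<dots> \<le> (X / r + r * (M - m) / 4)\<^sup>2"
  proof -
    \<comment> \<open>Completing the square in \<open>X / r\<close> leaves a nonnegative remainder;
      this is where the factor 1/4 comes from.\<close>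
    have "(X / r + r * (M - m) / 4)\<^sup>2 - ((M + m) * X - r\<^sup>2 * m * M)
        = (X / r - r * m - r * (M - m) / 4)\<^sup>2 + r\<^sup>2 * m * (M - m) / 2"
      using r(1) by (simp add: field_simps power2_eq_square)
    also have "\<dots> \<ge> 0" using assms(3,6) by simp
    finally show ?thesis by simp
  qed
  finally have "norm (restrict_vec T x) \<le> X / r + r * (M - m) / 4"
    by (rule power2_le_imp_le) (use X0 r assms(6) in simp)
  then show ?thesis by (simp add: X_def r_def)
qed

section \<open>The restricted isometry property\<close>

lemma restricted_isometry_mono:
  assumes "restricted_isometry A k \<delta>" "\<delta> \<le> \<epsilon>"
  shows "restricted_isometry A k \<epsilon>"
  unfolding restricted_isometry_def
proof (intro allI impI)
  fix x :: "real ^ 'a" assume "k_sparse k x"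
  with assms(1) have *: "(1 - \<delta>) * (norm x)\<^sup>2 \<le> (norm (A *v x))\<^sup>2"
    "(norm (A *v x))\<^sup>2 \<le> (1 + \<delta>) * (norm x)\<^sup>2"
    by (auto simp: restricted_isometry_def)
  have "\<delta> * (norm x)\<^sup>2 \<le> \<epsilon> * (norm x)\<^sup>2" using assms(2) by (simp add: mult_right_mono)
  with * show "(1 - \<epsilon>) * (norm x)\<^sup>2 \<le> (norm (A *v x))\<^sup>2 \<and>
      (norm (A *v x))\<^sup>2 \<le> (1 + \<epsilon>) * (norm x)\<^sup>2"
    by (simp add: algebra_simps)
qed

lemma psd_form_discriminant:
  fixes a b c :: real
  assumes "\<And>x y. 0 \<le> a * x\<^sup>2 + 2 * b * (x * y) + c * y\<^sup>2"
  shows "b\<^sup>2 \<le> a * c"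
proof (cases "c = 0")
  case True
  have "b = 0"
  proof (rule ccontr)
    assume "b \<noteq> 0"
    \<comment> \<open>For \<open>c = 0\<close> the form is affine in \<open>y\<close>; at this point
      its value is -1.\<close>
    then show False using assms[of 1 "- (a + 1) / (2 * b)"] True by simp
  qed
  then show ?thesis by (simp add: True)
next
  case False
  then have "c > 0" using assms[of 0 1] by simp
  \<comment> \<open>This is the value of the form at \<open>(c, - b)\<close>.\<close>
  moreover have "0 \<le> c * (a * c - b\<^sup>2)"
    using assms[of c "- b"] by (simp add: algebra_simps power2_eq_square)
  ultimately show ?thesis by (simp add: zero_le_mult_iff)
qed

text \<open>On the plane spanned by the orthogonal vectors \<open>u\<close> and \<open>w\<close>,
  the two isometry bounds are semidefinite quadratic forms, and each discriminant bounds the mixed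
  term. The bound is stated with \<open>(norm (A *v u))\<^sup>2\<close> because this factor cancels
  when \<open>A *v h = 0\<close>.\<close>

lemma restricted_isometry_inner_le:
  fixes A :: "real ^ 'p ^ 'n" and h :: "real ^ 'p"
  assumes rip: "restricted_isometry A s \<delta>" and \<delta>: "0 < \<delta>" "\<delta> < 1"
    and disj: "S \<inter> T = {}" and card: "card S + card T \<le> s"
  defines "u \<equiv> restrict_vec S h" and "w \<equiv> restrict_vec T h"
  shows "norm u * \<bar>(A *v u) \<bullet> (A *v w)\<bar> \<le> \<delta> / sqrt (1 - \<delta>\<^sup>2) * (norm (A *v u))\<^sup>2 * norm w"
proof -
  define P where "P = (norm (A *v u))\<^sup>2"
  define Q where "Q = (norm (A *v w))\<^sup>2"
  define b where "b = (A *v u) \<bullet> (A *v w)"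
  define a where "a = (norm u)\<^sup>2"
  define c where "c = (norm w)\<^sup>2"
  define d where "d = sqrt (1 - \<delta>\<^sup>2)"
  have d: "d > 0" "d\<^sup>2 = 1 - \<delta>\<^sup>2" using \<delta> by (auto simp: d_def power_le_one abs_square_less_1)
  have orth: "u \<bullet> w = 0"
    using disj by (auto simp: inner_vec_def u_def w_def intro!: sum.neutral)
  have sparse: "k_sparse s (x *\<^sub>R u + y *\<^sub>R w)" for x y
  proof (rule k_sparse_restrict[of "S \<union> T"])
    show "card (S \<union> T) \<le> s" using card_Un_le[of S T] card by linarith
  qed (simp add: u_def w_def)
  have norm_comb: "(norm (x *\<^sub>R u + y *\<^sub>R w))\<^sup>2 = a * x\<^sup>2 + c * y\<^sup>2" for x y
    by (simp only: power2_norm_eq_inner a_def c_def)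
      (simp add: inner_add_left inner_add_right orth inner_commute[of w u] power2_eq_square)
  have norm_A: "(norm (A *v (x *\<^sub>R u + y *\<^sub>R w)))\<^sup>2 = P * x\<^sup>2 + 2 * b * (x * y) + Q * y\<^sup>2" for x y
    by (simp only: power2_norm_eq_inner P_def Q_def b_def)
      (simp add: matrix_vector_right_distrib matrix_vector_mult_scaleR inner_add_left
        inner_add_right inner_commute[of "A *v w" "A *v u"] power2_eq_square algebra_simps)
  have rip': "(1 - \<delta>) * (a * x\<^sup>2 + c * y\<^sup>2) \<le> P * x\<^sup>2 + 2 * b * (x * y) + Q * y\<^sup>2"
    "P * x\<^sup>2 + 2 * b * (x * y) + Q * y\<^sup>2 \<le> (1 + \<delta>) * (a * x\<^sup>2 + c * y\<^sup>2)" for x y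
    using rip sparse[of x y] norm_comb[of x y] norm_A[of x y]
    unfolding restricted_isometry_def by metis+
  define l where "l = (1 + \<delta>) * a - P"
  define m where "m = P - (1 - \<delta>) * a"
  have lm: "0 \<le> l" "0 \<le> m" using rip'[of 1 0] by (auto simp: l_def m_def)
  have "b\<^sup>2 \<le> m * (Q - (1 - \<delta>) * c)"
    by (rule psd_form_discriminant) (use rip'(1) in \<open>simp add: m_def algebra_simps\<close>)
  then have 1: "l * b\<^sup>2 \<le> l * (m * (Q - (1 - \<delta>) * c))" using lm by (simp add: mult_left_mono)
  have "(- b)\<^sup>2 \<le> l * ((1 + \<delta>) * c - Q)"
  proof (rule psd_form_discriminant)
    show "0 \<le> l * x\<^sup>2 + 2 * - b * (x * y) + ((1 + \<delta>) * c - Q) * y\<^sup>2" for x y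
      using rip'(2)[of x y] by (simp add: l_def algebra_simps)
  qed
  then have 2: "m * b\<^sup>2 \<le> m * (l * ((1 + \<delta>) * c - Q))" using lm by (simp add: mult_left_mono)
  \<comment> \<open>The weights satisfy \<open>l + m = 2 * \<delta> * a\<close>, and with them the
    terms containing \<open>Q\<close> cancel.\<close>
  have "(2 * \<delta>) * (a * b\<^sup>2) = l * b\<^sup>2 + m * b\<^sup>2" by (simp add: l_def m_def algebra_simps)
  also have "\<dots> \<le> l * (m * (Q - (1 - \<delta>) * c)) + m * (l * ((1 + \<delta>) * c - Q))" using 1 2 by simp
  also have "\<dots> = (2 * \<delta>) * (l * m * c)" by (simp add: algebra_simps)
  finally have 3: "a * b\<^sup>2 \<le> l * m * c" using \<delta> by simp
  \<comment> \<open>This perfect square eliminates \<open>a\<close> from the bound and produces the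
    constant \<open>\<delta> / d\<close>.\<close>
  have "\<delta>\<^sup>2 * P\<^sup>2 - d\<^sup>2 * (l * m) = (P - d\<^sup>2 * a)\<^sup>2"
    unfolding d(2) l_def m_def by (simp add: algebra_simps power2_eq_square)
  then have "d\<^sup>2 * (l * m) \<le> \<delta>\<^sup>2 * P\<^sup>2" by (metis diff_ge_0_iff_ge zero_le_power2)
  then have "d\<^sup>2 * (l * m) * c \<le> \<delta>\<^sup>2 * P\<^sup>2 * c" by (simp add: mult_right_mono c_def)
  moreover have "d\<^sup>2 * (a * b\<^sup>2) \<le> d\<^sup>2 * (l * m * c)" using 3 by (simp add: mult_left_mono)
  ultimately have "d\<^sup>2 * (a * b\<^sup>2) \<le> \<delta>\<^sup>2 * P\<^sup>2 * c" by (simp add: mult.assoc)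
  then have "(d * (norm u * \<bar>b\<bar>))\<^sup>2 \<le> (\<delta> * P * norm w)\<^sup>2"
    by (simp add: power_mult_distrib a_def c_def)
  then have "d * (norm u * \<bar>b\<bar>) \<le> \<delta> * P * norm w"
    by (rule power2_le_imp_le) (use \<delta> in \<open>simp add: P_def\<close>)
  then show ?thesis using d(1) by (simp add: b_def P_def d_def[symmetric] field_simps)
qed

text \<open>Induction on the size of \<open>T\<close>: split off a block \<open>B\<close> of
  \<open>k\<close> largest entries. Its minimum \<open>m\<close> bounds the rest, so the induction
  hypothesis applies with \<open>m\<close> for \<open>M\<close>, and the contributions of
  \<open>M - m\<close> and \<open>m\<close> add up to that of \<open>M\<close>.\<close>

lemma restricted_isometry_inner_tail_le:
  fixes A :: "real ^ 'p ^ 'n" and h :: "real ^ 'p"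
  assumes rip: "restricted_isometry A (2 * k) \<delta>" and \<delta>: "0 < \<delta>" "\<delta> < 1"
    and k: "k > 0" and S: "card S \<le> k"
  defines "u \<equiv> restrict_vec S h"
  assumes "S \<inter> T = {}" and "0 \<le> M" and "\<And>i. i \<in> T \<Longrightarrow> \<bar>h $ i\<bar> \<le> M"
  shows "norm u * \<bar>(A *v u) \<bullet> (A *v restrict_vec T h)\<bar>
    \<le> \<delta> / sqrt (1 - \<delta>\<^sup>2) * (norm (A *v u))\<^sup>2 * ((\<Sum>i\<in>T. \<bar>h $ i\<bar>) / sqrt k + sqrt k * M / 4)"
  using assms(7-)
proof (induction "card T" arbitrary: T M rule: less_induct)
  case less
  define C where "C = \<delta> / sqrt (1 - \<delta>\<^sup>2) * (norm (A *v u))\<^sup>2"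
  have C: "C \<ge> 0" using \<delta> by (simp add: C_def power_le_one)
  show ?case
  proof (cases "card T \<le> k")
    case True
    have "norm u * \<bar>(A *v u) \<bullet> (A *v restrict_vec T h)\<bar> \<le> C * norm (restrict_vec T h)"
      unfolding C_def u_def
      by (rule restricted_isometry_inner_le[OF rip \<delta>]) (use less.prems True S in auto)
    also have "\<dots> \<le> C * ((\<Sum>i\<in>T. \<bar>h $ i\<bar>) / sqrt k + sqrt k * (M - 0) / 4)"
      by (intro mult_left_mono block_norm_le C) (use less.prems True k in auto)
    finally show ?thesis by (simp add: C_def)
  next
    case False
    obtain B where B: "B \<subseteq> T" "card B = k"
      "\<And>i j. i \<in> B \<Longrightarrow> j \<in> T - B \<Longrightarrow> \<bar>h $ j\<bar> \<le> \<bar>h $ i\<bar>"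
      using obtain_largest_subset[of T k "\<lambda>i. \<bar>h $ i\<bar>"] False by auto
    define m where "m = Min ((\<lambda>i. \<bar>h $ i\<bar>) ` B)"
    have "B \<noteq> {}" using B(2) k by auto
    then have m: "m \<in> (\<lambda>i. \<bar>h $ i\<bar>) ` B" "\<And>i. i \<in> B \<Longrightarrow> m \<le> \<bar>h $ i\<bar>"
      unfolding m_def by (auto intro!: Min_in)
    have m': "0 \<le> m" "m \<le> M" "\<And>j. j \<in> T - B \<Longrightarrow> \<bar>h $ j\<bar> \<le> m"
      using m(1) B less.prems(3) by auto
    have smaller: "card (T - B) < card T"
      using B \<open>B \<noteq> {}\<close> by (intro psubset_card_mono) auto
    let ?b = "\<lambda>T. (A *v u) \<bullet> (A *v restrict_vec T h)"
    have "T = B \<union> (T - B)" using B(1) by auto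
    then have "restrict_vec T h = restrict_vec B h + restrict_vec (T - B) h"
      by (metis restrict_vec_Un Diff_disjoint)
    then have "?b T = ?b B + ?b (T - B)"
      by (simp add: matrix_vector_right_distrib inner_add_right)
    then have "norm u * \<bar>?b T\<bar> \<le> norm u * (\<bar>?b B\<bar> + \<bar>?b (T - B)\<bar>)"
      by (intro mult_left_mono) auto
    also have "\<dots> = norm u * \<bar>?b B\<bar> + norm u * \<bar>?b (T - B)\<bar>" by (simp add: distrib_left)
    also have "norm u * \<bar>?b B\<bar> \<le> C * norm (restrict_vec B h)"
      unfolding C_def u_def
      by (rule restricted_isometry_inner_le[OF rip \<delta>]) (use less.prems B S in auto)
    also have "\<dots> \<le> C * ((\<Sum>i\<in>B. \<bar>h $ i\<bar>) / sqrt k + sqrt k * (M - m) / 4)"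
      by (intro mult_left_mono block_norm_le C) (use less.prems B k m m' in auto)
    also have "norm u * \<bar>?b (T - B)\<bar> \<le> C * ((\<Sum>i\<in>T - B. \<bar>h $ i\<bar>) / sqrt k + sqrt k * m / 4)"
      unfolding C_def by (rule less.hyps[OF smaller]) (use less.prems m' in auto)
    also have "C * ((\<Sum>i\<in>B. \<bar>h $ i\<bar>) / sqrt k + sqrt k * (M - m) / 4)
        + C * ((\<Sum>i\<in>T - B. \<bar>h $ i\<bar>) / sqrt k + sqrt k * m / 4)
        = C * (((\<Sum>i\<in>T - B. \<bar>h $ i\<bar>) + (\<Sum>i\<in>B. \<bar>h $ i\<bar>)) / sqrt k + sqrt k * M / 4)"
      by (simp add: algebra_simps add_divide_distrib diff_divide_distrib)
    also have "(\<Sum>i\<in>T - B. \<bar>h $ i\<bar>) + (\<Sum>i\<in>B. \<bar>h $ i\<bar>) = (\<Sum>i\<in>T. \<bar>h $ i\<bar>)"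
      using B(1) by (simp add: sum.subset_diff[of B T])
    finally show ?thesis by (simp add: C_def)
  qed
qed

section \<open>From restricted isometry to the null space property\<close>

lemma restricted_isometry_kernel_largest:
  fixes A :: "real ^ 'p ^ 'n" and h :: "real ^ 'p"
  assumes rip: "restricted_isometry A (2 * k) \<delta>" and \<delta>: "0 < \<delta>" "\<delta> < 1"
    and k: "k > 0" and ker: "A *v h = 0" and S: "card S = k"
    and largest: "\<And>i j. i \<in> S \<Longrightarrow> j \<notin> S \<Longrightarrow> \<bar>h $ j\<bar> \<le> \<bar>h $ i\<bar>"
  shows "(\<Sum>i\<in>S. \<bar>h $ i\<bar>)
    \<le> \<delta> / sqrt (1 - \<delta>\<^sup>2) * ((\<Sum>i\<in>- S. \<bar>h $ i\<bar>) + (\<Sum>i\<in>S. \<bar>h $ i\<bar>) / 4)"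
proof -
  define u where "u = restrict_vec S h"
  define D where "D = \<delta> / sqrt (1 - \<delta>\<^sup>2)"
  define X where "X = (\<Sum>i\<in>S. \<bar>h $ i\<bar>)"
  define Y where "Y = (\<Sum>i\<in>- S. \<bar>h $ i\<bar>)"
  have D: "D \<ge> 0" using \<delta> by (simp add: D_def power_le_one)
  have XY: "X \<ge> 0" "Y \<ge> 0" by (auto simp: X_def Y_def sum_nonneg)
  have X_le: "X \<le> sqrt k * norm u" using l1_le_sqrt_card_norm[of h S] by (simp add: X_def u_def S)
  have "X \<le> D * (Y + X / 4)"
  proof (cases "u = 0")
    case True
    then show ?thesis using X_le XY D by simp
  next
    case False
    \<comment> \<open>\<open>M\<close> bounds all entries outside \<open>S\<close>, while
      \<open>k * M\<close> is at most the l1 norm on \<open>S\<close>; this turns the boundary term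
      of the block estimate into \<open>X / 4\<close>.\<close>
    define M where "M = Min ((\<lambda>i. \<bar>h $ i\<bar>) ` S)"
    have "S \<noteq> {}" using S k by auto
    then have M: "M \<in> (\<lambda>i. \<bar>h $ i\<bar>) ` S" "\<And>i. i \<in> S \<Longrightarrow> M \<le> \<bar>h $ i\<bar>"
      unfolding M_def by (auto intro!: Min_in)
    have kM: "k * M \<le> X"
      unfolding X_def using sum_bounded_below[of S M "\<lambda>i. \<bar>h $ i\<bar>"] M(2) S by simp
    have "(1 - \<delta>) * (norm u)\<^sup>2 \<le> (norm (A *v u))\<^sup>2"
      using rip k_sparse_restrict[of S "2 * k" u] S
      by (auto simp: restricted_isometry_def u_def)
    moreover have "0 < (1 - \<delta>) * (norm u)\<^sup>2" using \<delta> False by simp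
    ultimately have pos: "(norm (A *v u))\<^sup>2 > 0" by linarith
    have "h = u + restrict_vec (- S) h" by (auto simp: u_def vec_eq_iff)
    then have "A *v u + A *v restrict_vec (- S) h = 0"
      using ker by (metis matrix_vector_right_distrib)
    \<comment> \<open>The inner product with the tail thus has absolute value
      \<open>(norm (A *v u))\<^sup>2\<close>, which is positive and can be divided out.\<close>
    then have eq: "A *v restrict_vec (- S) h = - (A *v u)"
      by (simp add: eq_neg_iff_add_eq_0 add.commute)
    have "norm u * \<bar>(A *v u) \<bullet> (A *v restrict_vec (- S) h)\<bar>
        \<le> D * (norm (A *v u))\<^sup>2 * (Y / sqrt k + sqrt k * M / 4)"
      unfolding D_def u_def Y_def
      by (rule restricted_isometry_inner_tail_le[OF rip \<delta> k]) (use S M(1) largest in auto)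
    then have "norm u * (norm (A *v u))\<^sup>2
        \<le> (D * (Y / sqrt k + sqrt k * M / 4)) * (norm (A *v u))\<^sup>2"
      unfolding eq by (simp add: power2_norm_eq_inner mult_ac)
    then have "norm u \<le> D * (Y / sqrt k + sqrt k * M / 4)" using pos by simp
    then have "sqrt k * norm u \<le> sqrt k * (D * (Y / sqrt k + sqrt k * M / 4))"
      by (simp add: mult_left_mono)
    also have "\<dots> = D * (Y + k * M / 4)" using k by (simp add: field_simps)
    also have "\<dots> \<le> D * (Y + X / 4)" using kM D by (intro mult_left_mono) auto
    finally show ?thesis using X_le by simp
  qed
  then show ?thesis by (simp add: D_def X_def Y_def)
qed

theorem restricted_isometry_null_space_property:
  fixes A :: "real ^ 'p ^ 'n" and h :: "real ^ 'p"
  assumes rip: "restricted_isometry A (2 * k) \<delta>" and \<delta>: "0 < \<delta>" "\<delta> < 1"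
    and k: "k > 0" and ker: "A *v h = 0" and "h \<noteq> 0" and S: "card S \<le> k"
    and \<rho>: "\<rho> > 0" and small: "(\<rho> + 1 / 4) * (\<delta> / sqrt (1 - \<delta>\<^sup>2)) < 1"
  shows "\<rho> * (\<Sum>i\<in>S. \<bar>h $ i\<bar>) < (\<Sum>i\<in>- S. \<bar>h $ i\<bar>)"
proof -
  define D where "D = \<delta> / sqrt (1 - \<delta>\<^sup>2)"
  have D: "D \<ge> 0" using \<delta> by (simp add: D_def power_le_one)
  \<comment> \<open>Otherwise \<open>h\<close> itself would be \<open>2 * k\<close>-sparse, and
    restricted isometry would force \<open>h = 0\<close>.\<close>
  have card: "k < CARD('p)"
  proof (rule ccontr)
    assume "\<not> k < CARD('p)"
    then have "k_sparse (2 * k) h" by (intro k_sparse_restrict[of UNIV]) auto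
    then have "(1 - \<delta>) * (norm h)\<^sup>2 \<le> (norm (A *v h))\<^sup>2"
      using rip by (simp add: restricted_isometry_def)
    then show False using ker \<delta> \<open>h \<noteq> 0\<close> by (simp add: mult_le_0_iff)
  qed
  obtain L where L: "card L = k" "\<And>i j. i \<in> L \<Longrightarrow> j \<notin> L \<Longrightarrow> \<bar>h $ j\<bar> \<le> \<bar>h $ i\<bar>"
    using obtain_largest_subset[of UNIV k "\<lambda>i. \<bar>h $ i\<bar>"] card by auto
  define X where "X = (\<Sum>i\<in>L. \<bar>h $ i\<bar>)"
  define Y where "Y = (\<Sum>i\<in>- L. \<bar>h $ i\<bar>)"
  have split: "(\<Sum>i\<in>T. \<bar>h $ i\<bar>) + (\<Sum>i\<in>- T. \<bar>h $ i\<bar>) = l1_norm h" for T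
    unfolding l1_norm_def Compl_eq_Diff_UNIV
    using sum.subset_diff[of T UNIV "\<lambda>i. \<bar>h $ i\<bar>"] by simp
  have "l1_norm h > 0"
  proof -
    obtain i where "h $ i \<noteq> 0" using \<open>h \<noteq> 0\<close> by (auto simp: vec_eq_iff)
    then show ?thesis unfolding l1_norm_def by (intro sum_pos2[of _ i]) auto
  qed
  then have pos: "X + Y > 0" using split[of L] by (simp add: X_def Y_def)
  have XY: "X \<ge> 0" "Y \<ge> 0" by (auto simp: X_def Y_def sum_nonneg)
  have main: "X \<le> D * (Y + X / 4)"
    unfolding X_def Y_def D_def
    by (rule restricted_isometry_kernel_largest[OF rip \<delta> k ker L])
  have "\<rho> * X < Y"
  proof (rule ccontr)
    assume "\<not> \<rho> * X < Y"
    then have le: "Y \<le> \<rho> * X" by simp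
    then have "X > 0" using pos XY by (metis add_cancel_left_left le_less mult_zero_right order_antisym)
    have "D * (Y + X / 4) \<le> D * (\<rho> * X + X / 4)" using le D by (intro mult_left_mono) auto
    also have "\<dots> = (\<rho> + 1 / 4) * D * X" by (simp add: algebra_simps)
    also have "\<dots> < 1 * X"
      using small \<open>X > 0\<close> by (intro mult_strict_right_mono) (auto simp: D_def)
    finally show False using main by simp
  qed
  \<comment> \<open>Passing from \<open>L\<close> to \<open>S\<close> does not increase the sum
    inside; since the total is fixed, it does not decrease the sum outside.\<close>
  moreover have "(\<Sum>i\<in>S. \<bar>h $ i\<bar>) \<le> X"
    unfolding X_def by (rule sum_le_sum_largest) (use S L in auto)
  moreover from this have "\<rho> * (\<Sum>i\<in>S. \<bar>h $ i\<bar>) \<le> \<rho> * X" using \<rho> by simp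
  ultimately show ?thesis using split[of S] split[of L] by (simp add: X_def Y_def)
qed

section \<open>The penalty\<close>

lemma phi_nonneg: "\<alpha> > 0 \<Longrightarrow> 0 \<le> phi \<alpha> t"
  by (simp add: phi_def)

lemma phi_le: "\<alpha> > 0 \<Longrightarrow> phi \<alpha> t \<le> \<alpha> * \<bar>t\<bar>"
  by (simp add: phi_def divide_le_eq mult_le_cancel_left1 add_pos_nonneg)

text \<open>The map sending \<open>a\<close> to \<open>a / (1 + a)\<close> is increasing and
  subadditive for a \<ge> 0; it is applied to
  \<open>\<bar>s\<bar> \<le> \<bar>s + t\<bar> + \<bar>t\<bar>\<close>.\<close>

lemma phi_diff_ge:
  assumes "\<alpha> > 0"
  shows "phi \<alpha> (s + t) \<ge> phi \<alpha> s - phi \<alpha> t"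
proof -
  define a where "a = \<alpha> * \<bar>s\<bar>"
  define b where "b = \<alpha> * \<bar>t\<bar>"
  define c where "c = \<alpha> * \<bar>s + t\<bar>"
  have "\<alpha> * \<bar>s\<bar> \<le> \<alpha> * (\<bar>s + t\<bar> + \<bar>t\<bar>)" using assms by (intro mult_left_mono) auto
  then have abc: "a \<ge> 0" "b \<ge> 0" "c \<ge> 0" "a \<le> b + c"
    using assms by (auto simp: a_def b_def c_def algebra_simps)
  have "a / (1 + a) \<le> (b + c) / (1 + (b + c))" using abc by (simp add: field_simps)
  also have "\<dots> = b / (1 + (b + c)) + c / (1 + (b + c))" by (simp add: add_divide_distrib)
  also have "\<dots> \<le> b / (1 + b) + c / (1 + c)"
    using abc by (intro add_mono divide_left_mono) auto
  finally show ?thesis by (simp add: phi_def a_def b_def c_def)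
qed

section \<open>Uniqueness of the minimizer\<close>

theorem theorem3p2:
  fixes \<alpha> \<beta> :: real and A :: "real ^ 'p ^ 'n" and k :: nat
    and x0 :: "real ^ 'p" and y :: "real ^ 'n"
  assumes "\<alpha> > 0" and "\<beta> > 0"
    and "k > 0"
    and "k_sparse k x0"
    and "ric A (2 * k) \<le> 0.4663"
    and "\<beta> \<le> 1 / (20 * \<alpha>)"
    and "y = A *v x0"
  shows "{x. is_arg_min (\<lambda>x. l1_norm x + \<beta> * Phi \<alpha> x) (\<lambda>x. A *v x = y) x} = {x0}"
proof -
  define F where "F t = \<bar>t\<bar> + \<beta> * phi \<alpha> t" for t
  have cost: "l1_norm x + \<beta> * Phi \<alpha> x = (\<Sum>i\<in>UNIV. F (x $ i))" for x :: "real ^ 'p"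
    by (simp add: l1_norm_def Phi_def F_def sum.distrib sum_distrib_left)
  have F_ge: "\<bar>t\<bar> \<le> F t" for t using phi_nonneg[OF assms(1)] assms(2) by (simp add: F_def)
  have F_le: "F t \<le> 21 / 20 * \<bar>t\<bar>" for t
  proof -
    have "\<beta> * phi \<alpha> t \<le> 1 / (20 * \<alpha>) * (\<alpha> * \<bar>t\<bar>)"
      using assms phi_le[OF assms(1)] phi_nonneg[OF assms(1)] by (intro mult_mono) auto
    then show ?thesis using assms(1) by (simp add: F_def)
  qed
  have F_diff: "F (s + t) \<ge> F s - F t" for s t
  proof -
    have "\<beta> * phi \<alpha> (s + t) \<ge> \<beta> * (phi \<alpha> s - phi \<alpha> t)"
      using phi_diff_ge[OF assms(1)] assms(2) by (intro mult_left_mono) auto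
    moreover have "\<bar>s + t\<bar> \<ge> \<bar>s\<bar> - \<bar>t\<bar>" by linarith
    ultimately show ?thesis unfolding F_def by (simp add: algebra_simps)
  qed
  \<comment> \<open>Enlarging the constant to 0.4663 makes it strictly positive even if
    \<open>ric A (2 * k)\<close> is 0.\<close>
  have rip: "restricted_isometry A (2 * k) 0.4663"
    using ric_least(2) assms(5) by (rule restricted_isometry_mono)
  \<comment> \<open>39/50 is a convenient rational below the root: it makes the quotient smaller
    than 3/5, and 13/10 * 3/5 < 1.\<close>
  have "sqrt ((39 / 50)\<^sup>2) \<le> sqrt (1 - (0.4663::real)\<^sup>2)"
    by (subst real_sqrt_le_iff) (simp add: power2_eq_square)
  then have "39 / 50 \<le> sqrt (1 - (0.4663::real)\<^sup>2)" by simp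
  then have "(0.4663::real) / sqrt (1 - 0.4663\<^sup>2) \<le> 0.4663 / (39 / 50)"
    by (intro divide_left_mono) (auto simp: power2_eq_square)
  then have small: "(21 / 20 + 1 / 4) * ((0.4663::real) / sqrt (1 - 0.4663\<^sup>2)) < 1" by simp
  define S where "S = {i. x0 $ i \<noteq> 0}"
  have S: "card S \<le> k" using assms(4) by (simp add: S_def k_sparse_def)
  have sum_split: "sum f UNIV = sum f S + sum f (- S)" for f :: "'p \<Rightarrow> real"
    using sum.subset_diff[of S UNIV f] by (simp add: Compl_eq_Diff_UNIV)
  have less: "l1_norm x0 + \<beta> * Phi \<alpha> x0 < l1_norm x + \<beta> * Phi \<alpha> x"
    if x: "A *v x = y" "x \<noteq> x0" for x
  proof -
    define h where "h = x - x0"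
    have h: "A *v h = 0" "h \<noteq> 0" and xi: "\<And>i. x $ i = x0 $ i + h $ i"
      using x assms(7) by (auto simp: h_def matrix_vector_mult_diff_distrib)
    have nsp: "21 / 20 * (\<Sum>i\<in>S. \<bar>h $ i\<bar>) < (\<Sum>i\<in>- S. \<bar>h $ i\<bar>)"
      by (rule restricted_isometry_null_space_property[OF rip _ _ assms(3) h S _ small]) auto
    have F0: "F (x0 $ i) = 0" "x $ i = h $ i" if "i \<in> - S" for i
      using that by (auto simp: S_def F_def phi_def xi)
    \<comment> \<open>On \<open>S\<close>, passing from \<open>x0\<close> to \<open>x\<close> saves
      at most 21/20 times the l1 norm of \<open>h\<close> there. Off \<open>S\<close>,
      \<open>x\<close> agrees with \<open>h\<close> and costs at least its l1 norm, which is
      strictly more by \<open>nsp\<close>.\<close>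
    have "(\<Sum>i\<in>UNIV. F (x0 $ i)) = (\<Sum>i\<in>S. F (x0 $ i))"
      by (simp add: sum_split F0)
    also have "\<dots> \<le> (\<Sum>i\<in>S. F (x $ i) + 21 / 20 * \<bar>h $ i\<bar>)"
    proof (rule sum_mono)
      fix i
      show "F (x0 $ i) \<le> F (x $ i) + 21 / 20 * \<bar>h $ i\<bar>"
        using F_diff[of "x0 $ i" "h $ i"] F_le[of "h $ i"] by (simp add: xi)
    qed
    also have "\<dots> = (\<Sum>i\<in>S. F (x $ i)) + 21 / 20 * (\<Sum>i\<in>S. \<bar>h $ i\<bar>)"
      by (simp add: sum.distrib sum_distrib_left)
    also have "\<dots> < (\<Sum>i\<in>S. F (x $ i)) + (\<Sum>i\<in>- S. \<bar>h $ i\<bar>)" using nsp by simp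
    also have "\<dots> \<le> (\<Sum>i\<in>S. F (x $ i)) + (\<Sum>i\<in>- S. F (x $ i))"
      using F0(2) F_ge by (intro add_mono sum_mono) auto
    also have "\<dots> = (\<Sum>i\<in>UNIV. F (x $ i))" by (simp add: sum_split)
    finally show ?thesis by (simp add: cost)
  qed
  show ?thesis
  proof (intro set_eqI iffI)
    fix x assume "x \<in> {x. is_arg_min (\<lambda>x. l1_norm x + \<beta> * Phi \<alpha> x) (\<lambda>x. A *v x = y) x}"
    then show "x \<in> {x0}" using less[of x] assms(7) by (auto simp: is_arg_min_def)
  next
    fix x assume "x \<in> {x0}"
    then show "x \<in> {x. is_arg_min (\<lambda>x. l1_norm x + \<beta> * Phi \<alpha> x) (\<lambda>x. A *v x = y) x}"
      using less assms(7) by (force simp: is_arg_min_def)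
  qed
qed

end
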